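(* Let $\Phi=(G,\varphi)$ be a $\mathbb{T}$-gain graph on a connected bipartite graph $G$. Then $A(\Phi)$ has exactly one positive eigenvalue if and only if $\Phi$ is a balanced $\mathbb{T}$-gain graph whose underlying graph $G$ is complete bipartite.
   Context: A $\mathbb{T}$-gain graph $\Phi=(G,\varphi)$ consists of a finite simple graph $G$ and a map $\varphi$ assigning to each orientation $\overrightarrow{e_{p,q}}$ of each edge $v_pv_q$ a value in $\mathbb{T}=\{z\in\mathbb{C}:|z|=1\}$, with $\varphi(\overrightarrow{e_{q,p}})=\varphi(\overrightarrow{e_{p,q}})^{-1}$. Its adjacency matrix $A(\Phi)$ is the Hermitian matrix whose $(p,q)$ entry is $\varphi(\overrightarrow{e_{p,q}})$ if $v_p\sim v_q$ and $0$ otherwise. The gain of an oriented cycle is the product of the gains along its oriented edges; $\Phi$ is balanced if every oriented cycle has gain $1$. *)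

theory Defs
  imports
    "Graph_Theory.Graph_Theory"
    "Jordan_Normal_Form.Char_Poly"
    "HOL-Computational_Algebra.Polynomial"
begin

text \<open>
  A simple graph is a \<^locale>\<open>pair_graph\<close>: each edge \<open>v\<^sub>pv\<^sub>q\<close> is given by its two
  orientations \<open>(v\<^sub>p, v\<^sub>q)\<close> and \<open>(v\<^sub>q, v\<^sub>p)\<close>. The values of \<open>\<phi>\<close> outside \<open>parcs G\<close> are irrelevant.
\<close>

locale T_gain_graph = pair_graph G
  for G :: "'a pair_pre_digraph" +
  fixes \<phi> :: "'a \<times> 'a \<Rightarrow> complex"
  assumes gain_unit: "e \<in> parcs G \<Longrightarrow> cmod (\<phi> e) = 1"
    and gain_reverse: "(u, v) \<in> parcs G \<Longrightarrow> \<phi> (v, u) = inverse (\<phi> (u, v))"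

definition gain :: "('a \<times> 'a \<Rightarrow> complex) \<Rightarrow> ('a \<times> 'a) list \<Rightarrow> complex" where
  "gain \<phi> p = (\<Prod>e\<leftarrow>p. \<phi> e)"

text \<open>
  \<^const>\<open>pre_digraph.cycle\<close> also admits the closed walks \<open>u, v, u\<close> along a single edge; the length
  condition leaves exactly the oriented cycles of the simple graph.
\<close>

definition balanced :: "'a pair_pre_digraph \<Rightarrow> ('a \<times> 'a \<Rightarrow> complex) \<Rightarrow> bool" where
  "balanced G \<phi> \<longleftrightarrow>
    (\<forall>p. pre_digraph.cycle (with_proj G) p \<and> 3 \<le> length p \<longrightarrow> gain \<phi> p = 1)"

text \<open>The list \<open>vs\<close> is the enumeration \<open>v\<^sub>1, \<dots>, v\<^sub>n\<close> of the vertices that indexes the matrix.\<close>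

definition adjacency_mat ::
  "'a list \<Rightarrow> 'a pair_pre_digraph \<Rightarrow> ('a \<times> 'a \<Rightarrow> complex) \<Rightarrow> complex mat" where
  "adjacency_mat vs G \<phi> = Matrix.mat (length vs) (length vs)
    (\<lambda>(p, q). if (vs ! p, vs ! q) \<in> parcs G then \<phi> (vs ! p, vs ! q) else 0)"

definition bipartite :: "'a pair_pre_digraph \<Rightarrow> bool" where
  "bipartite G \<longleftrightarrow> (\<exists>U V. pverts G = U \<union> V \<and> U \<inter> V = {} \<and> parcs G \<subseteq> U \<times> V \<union> V \<times> U)"

text \<open>Both parts are nonempty, so the one-vertex graph is bipartite but not complete bipartite.\<close>

definition complete_bipartite :: "'a pair_pre_digraph \<Rightarrow> bool" where
  "complete_bipartite G \<longleftrightarrow>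
    (\<exists>m n. 1 \<le> m \<and> 1 \<le> n \<and> complete_bipartite_digraph m n (with_proj G))"

text \<open>
  Eigenvalues are counted with multiplicity. The algebraic multiplicity is used; for Hermitian
  matrices it agrees with the geometric one.
\<close>

definition num_pos_eigenvalues :: "complex mat \<Rightarrow> nat" where
  "num_pos_eigenvalues A =
    (\<Sum>x | 0 < x \<and> eigenvalue A (complex_of_real x).
       Polynomial.order (complex_of_real x) (char_poly A))"

end

theory Submission
  imports Defs "Jordan_Normal_Form.Schur_Decomposition"
begin

text \<open>
  Both implications go through the traces of powers of the adjacency matrix \<open>A\<close>, whose odd powers
  have trace zero because the graph is bipartite. If \<open>l\<close> is the only positive eigenvalue, then
  \<open>tr A = tr A\<^sup>3 = 0\<close> forces the remaining eigenvalues to lie in \<open>{0, -l}\<close>, whence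
  \<open>(tr A\<^sup>2)\<^sup>2 = 2 tr A\<^sup>4\<close>. By Lagrange's identity, \<open>(tr A\<^sup>2)\<^sup>2 - 2 tr A\<^sup>4\<close> is the sum of the squared moduli
  of the 2-by-2 minors of \<open>A\<close> whose two rows lie in the same part, so all these minors vanish. This makes
  the ends of every walk of length three adjacent, and exhibits the gains as quotients of a potential.
  Conversely, balanced 4-cycles give \<open>A\<^sup>3 = c A\<close> with \<open>c = |U| |V|\<close>; together with \<open>tr A = 0\<close>
  and \<open>tr A\<^sup>2 = 2 c\<close> this leaves one positive eigenvalue.
\<close>

section \<open>Spectra of Hermitian matrices and traces of powers\<close>

definition mat_trace :: "'a::comm_monoid_add mat \<Rightarrow> 'a" where
  "mat_trace A = (\<Sum>i<dim_row A. A $$ (i, i))"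

lemma index_mult_mat_sum:
  assumes "A \<in> carrier_mat n m" "B \<in> carrier_mat m k" "i < n" "j < k"
  shows "(A * B) $$ (i, j) = (\<Sum>l<m. A $$ (i, l) * B $$ (l, j))"
  using assms by (auto simp: scalar_prod_def atLeast0LessThan intro!: sum.cong)

lemma mat_trace_mult:
  fixes A B :: "'a::comm_semiring_0 mat"
  assumes "A \<in> carrier_mat n m" "B \<in> carrier_mat m n"
  shows "mat_trace (A * B) = (\<Sum>i<n. \<Sum>j<m. A $$ (i, j) * B $$ (j, i))"
  using assms by (auto simp: mat_trace_def index_mult_mat_sum simp del: index_mult_mat(1))

lemma mat_trace_comm:
  fixes A B :: "'a::comm_semiring_0 mat"
  assumes "A \<in> carrier_mat n m" "B \<in> carrier_mat m n"
  shows "mat_trace (A * B) = mat_trace (B * A)"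
  unfolding mat_trace_mult[OF assms] mat_trace_mult[OF assms(2,1)]
  by (subst sum.swap) (simp add: mult.commute)

lemma mat_trace_similar:
  fixes A B :: "'a::comm_ring_1 mat"
  assumes "similar_mat_wit A B P Q"
  shows "mat_trace A = mat_trace B"
proof -
  define n where "n = dim_row A"
  note w = similar_mat_witD[OF n_def assms]
  have "mat_trace A = mat_trace (P * B * Q)"
    using w(3) by simp
  also have "\<dots> = mat_trace (Q * (P * B))"
    by (rule mat_trace_comm[of _ n n]) (use w in auto)
  also have "Q * (P * B) = Q * P * B"
    by (rule assoc_mult_mat[symmetric]) (use w in auto)
  also have "\<dots> = B"
    using w by simp
  finally show ?thesis .
qed

text \<open>Prepares the trace of a power in Schur form, where the diagonal lists the
  eigenvalues.\<close>

lemma upper_triangular_pow: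
  fixes B :: "'a::comm_ring_1 mat"
  assumes B: "B \<in> carrier_mat n n" and ut: "upper_triangular B"
  shows "upper_triangular (B ^\<^sub>m k) \<and> (\<forall>i<n. (B ^\<^sub>m k) $$ (i, i) = (B $$ (i, i)) ^ k)"
proof (induction k)
  case 0
  show ?case using B by auto
next
  case (Suc k)
  let ?C = "B ^\<^sub>m k"
  have C: "?C \<in> carrier_mat n n" using B by simp
  \<comment> \<open>A nonzero term needs \<open>i \<le> l\<close> from the first factor and
    \<open>l \<le> j\<close> from the second; with \<open>j \<le> i\<close> only
    \<open>l = i = j\<close> is left.\<close>
  have tri: "?C $$ (i, l) * B $$ (l, j) = 0" if "j \<le> i" "i < n" "l < n" "\<not> (l = i \<and> j = i)" for i j l
  proof (cases "l < i")
    case True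
    then show ?thesis using Suc.IH C that by (auto dest: upper_triangularD)
  next
    case False
    then have "B $$ (l, j) = 0"
      by (intro upper_triangularD[OF ut]) (use B that in auto)
    then show ?thesis by simp
  qed
  have e: "(B ^\<^sub>m Suc k) $$ (i, j) = (\<Sum>l<n. ?C $$ (i, l) * B $$ (l, j))" if "i < n" "j < n" for i j
    using index_mult_mat_sum[OF C B that] by simp
  have "(B ^\<^sub>m Suc k) $$ (i, j) = 0" if "j < i" "i < n" for i j
    using that tri by (subst e) (auto intro!: sum.neutral)
  moreover have "(B ^\<^sub>m Suc k) $$ (i, i) = (B $$ (i, i)) ^ Suc k" if "i < n" for i
  proof -
    have "(\<Sum>l<n. ?C $$ (i, l) * B $$ (l, i)) = (\<Sum>l\<in>{i}. ?C $$ (i, l) * B $$ (l, i))"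
      using that tri by (intro sum.mono_neutral_right) auto
    then show ?thesis using that Suc.IH by (simp only: e) simp
  qed
  ultimately show ?case using B C by (auto intro!: upper_triangularI)
qed

text \<open>Schur triangulation is compatible with powers and keeps the trace, so only the diagonal
  of the triangular factor counts.\<close>

lemma mat_trace_pow:
  fixes A :: "'a::conjugatable_ordered_field mat"
  assumes A: "A \<in> carrier_mat n n" and c: "char_poly A = (\<Prod>a\<leftarrow>as. [:- a, 1:])"
  shows "mat_trace (A ^\<^sub>m k) = (\<Sum>a\<leftarrow>as. a ^ k)"
proof -
  obtain B P Q where "schur_decomposition A as = (B, P, Q)"
    by (cases "schur_decomposition A as") auto
  from schur_decomposition[OF A c this]
  have sim: "similar_mat_wit A B P Q" and ut: "upper_triangular B" and d: "diag_mat B = as"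
    by auto
  have B: "B \<in> carrier_mat n n"
    using similar_mat_witD2[OF A sim] by auto
  have "mat_trace (A ^\<^sub>m k) = mat_trace (B ^\<^sub>m k)"
    by (rule mat_trace_similar[OF similar_mat_wit_pow[OF sim]])
  also have "\<dots> = (\<Sum>i<n. (B $$ (i, i)) ^ k)"
    using B upper_triangular_pow[OF B ut, of k] by (auto simp: mat_trace_def)
  also have "\<dots> = (\<Sum>a\<leftarrow>as. a ^ k)"
    using B unfolding d[symmetric]
    by (simp add: diag_mat_def o_def interv_sum_list_conv_sum_set_nat atLeast0LessThan)
  finally show ?thesis .
qed

section \<open>Real spectra of Hermitian matrices\<close>

text \<open>The value \<open>s\<close> of the Hermitian form at an eigenvector equals its own
  conjugate, and it is \<open>a\<close> times the squared norm \<open>r\<close>, which is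
  nonzero.\<close>

lemma hermitian_eigenvalue_real:
  fixes A :: "complex mat"
  assumes A: "A \<in> carrier_mat n n"
    and herm: "\<And>i j. i < n \<Longrightarrow> j < n \<Longrightarrow> A $$ (j, i) = cnj (A $$ (i, j))"
    and ev: "eigenvalue A a"
  shows "a \<in> \<real>"
proof -
  obtain v where v: "v \<in> carrier_vec n" "v \<noteq> 0\<^sub>v n" "A *\<^sub>v v = a \<cdot>\<^sub>v v"
    using ev A by (auto simp: eigenvalue_def eigenvector_def)
  have Av: "(\<Sum>j<n. A $$ (i, j) * v $ j) = a * v $ i" if "i < n" for i
    using arg_cong[OF v(3), of "\<lambda>w. w $ i"] that A v(1)
    by (auto simp: scalar_prod_def atLeast0LessThan)
  define s where "s = (\<Sum>i<n. cnj (v $ i) * (\<Sum>j<n. A $$ (i, j) * v $ j))"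
  define r where "r = (\<Sum>i<n. (cmod (v $ i))\<^sup>2)"
  have "s = (\<Sum>i<n. cnj (v $ i) * (a * v $ i))"
    unfolding s_def by (intro sum.cong) (auto simp: Av)
  also have "\<dots> = a * of_real r"
    unfolding r_def by (simp add: sum_distrib_left complex_norm_square mult_ac del: of_real_power)
  finally have s: "s = a * of_real r" .
  have "cnj s = (\<Sum>i<n. \<Sum>j<n. v $ i * (A $$ (j, i) * cnj (v $ j)))"
    unfolding s_def by (auto simp: sum_distrib_left herm[symmetric] intro!: sum.cong)
  also have "\<dots> = s"
    unfolding s_def by (subst sum.swap) (simp add: sum_distrib_left mult_ac)
  finally have "cnj a * of_real r = a * of_real r"
    unfolding s by simp
  moreover have "r \<noteq> 0"
  proof
    assume "r = 0"
    then have "\<forall>i<n. v $ i = 0"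
      unfolding r_def by (subst (asm) sum_nonneg_eq_0_iff) auto
    then show False
      using v(1,2) by (auto intro!: eq_vecI)
  qed
  ultimately have "cnj a = a" by simp
  then show ?thesis by (simp add: Reals_cnj_iff)
qed

lemma order_prod_linear_factors:
  fixes as :: "'a::idom list"
  shows "Polynomial.order x (\<Prod>a\<leftarrow>as. [:- a, 1:]) = count_list as x"
proof (induction as)
  case (Cons a as)
  have "[:- a, 1:] * (\<Prod>a\<leftarrow>as. [:- a, 1:]) \<noteq> 0"
    by (auto simp: prod_list_zero_iff simp del: mult_pCons_left)
  then have "Polynomial.order x (\<Prod>a\<leftarrow>a # as. [:- a, 1:])
    = Polynomial.order x [:- a, 1:] + count_list as x"
    by (simp add: order_mult Cons.IH del: mult_pCons_left)
  moreover have "Polynomial.order x [:- a, 1:] = (if a = x then 1 else 0)"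
    using order_power_n_n[of x 1] by (auto intro: order_0I)
  ultimately show ?case by simp
qed (simp add: order_0I)

text \<open>Trades the complex spectrum for a list of reals repeated by multiplicity, so that
  counting positive eigenvalues becomes a question about power sums.\<close>

lemma hermitian_spectrum:
  fixes A :: "complex mat"
  assumes A: "A \<in> carrier_mat n n"
    and herm: "\<And>i j. i < n \<Longrightarrow> j < n \<Longrightarrow> A $$ (j, i) = cnj (A $$ (i, j))"
  obtains rs :: "real list" where
    "num_pos_eigenvalues A = length (filter (\<lambda>r. 0 < r) rs)"
    "\<And>r. r \<in> set rs \<Longrightarrow> eigenvalue A (complex_of_real r)"
    "\<And>k. mat_trace (A ^\<^sub>m k) = complex_of_real (\<Sum>r\<leftarrow>rs. r ^ k)"
proof -
  obtain as where c: "char_poly A = (\<Prod>a\<leftarrow>as. [:- a, 1:])"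
    using char_poly_factorized[OF A] by auto
  have ev: "eigenvalue A a \<longleftrightarrow> a \<in> set as" for a
    unfolding eigenvalue_root_char_poly[OF A] c
    by (auto simp: poly_prod_list prod_list_zero_iff o_def)
  define rs where "rs = map Re as"
  have as: "as = map complex_of_real rs"
    using hermitian_eigenvalue_real[OF A herm] ev
    by (auto simp: rs_def o_def intro!: map_idI[symmetric])
  have ev_rs: "eigenvalue A (complex_of_real r) \<longleftrightarrow> r \<in> set rs" for r
    unfolding ev as by auto
  have ord: "Polynomial.order (complex_of_real r) (char_poly A) = count_list rs r" for r
    unfolding c order_prod_linear_factors as by (rule count_list_map_conv) (auto intro: injI)
  have "num_pos_eigenvalues A = (\<Sum>x\<in>{x. 0 < x \<and> x \<in> set rs}. count_list rs x)"
    unfolding num_pos_eigenvalues_def ord ev_rs ..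
  also have "\<dots> = (\<Sum>x\<in>set (filter (\<lambda>r. 0 < r) rs). count_list (filter (\<lambda>r. 0 < r) rs) x)"
    by (intro sum.cong) (auto simp: count_list_eq_length_filter conj_commute intro!: arg_cong[of _ _ length] filter_cong)
  also have "\<dots> = length (filter (\<lambda>r. 0 < r) rs)"
    by (rule sum_count_set) auto
  finally have 1: "num_pos_eigenvalues A = length (filter (\<lambda>r. 0 < r) rs)" .
  have 2: "mat_trace (A ^\<^sub>m k) = complex_of_real (\<Sum>r\<leftarrow>rs. r ^ k)" for k
    unfolding mat_trace_pow[OF A c] as by (induction rs) auto
  show thesis
    using that[OF 1 _ 2] ev_rs by blast
qed

section \<open>Power sums that detect a single positive entry\<close>

text \<open>The entries turn out to be the positive \<open>l\<close>, a single \<open>- l\<close>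
  and zeros, which determines both power sums.\<close>

lemma one_positive_power_sums:
  fixes rs :: "real list"
  assumes one: "length (filter (\<lambda>r. 0 < r) rs) = 1"
    and s1: "(\<Sum>r\<leftarrow>rs. r) = 0" and s3: "(\<Sum>r\<leftarrow>rs. r ^ 3) = 0"
  shows "(\<Sum>r\<leftarrow>rs. r\<^sup>2) > 0" "2 * (\<Sum>r\<leftarrow>rs. r ^ 4) = (\<Sum>r\<leftarrow>rs. r\<^sup>2)\<^sup>2"
proof -
  obtain l where l: "filter (\<lambda>r. 0 < r) rs = [l]"
    using one by (auto simp: length_Suc_conv)
  then have pos: "l > 0"
    by (metis filter_eq_ConsD)
  define ns where "ns = filter (\<lambda>r. \<not> 0 < r) rs"
  have split: "(\<Sum>r\<leftarrow>rs. f r) = f l + (\<Sum>r\<leftarrow>ns. f r)" for f :: "real \<Rightarrow> real"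
  proof -
    have "(\<Sum>r\<leftarrow>rs. f r) = (\<Sum>r\<leftarrow>filter (\<lambda>r. 0 < r) rs. f r) + (\<Sum>r\<leftarrow>ns. f r)"
      unfolding ns_def by (induction rs) auto
    then show ?thesis unfolding l by simp
  qed
  have np: "r \<le> 0" if "r \<in> set ns" for r
    using that by (auto simp: ns_def)
  have ge: "- l \<le> r" if "r \<in> set ns" for r
  proof -
    have "- r \<le> (\<Sum>r\<leftarrow>ns. - r)"
      using that np by (intro member_le_sum_list) auto
    also have "\<dots> = l"
      using s1 split[of "\<lambda>r. r"] uminus_sum_list_map[of "\<lambda>r. r" ns] by (simp add: o_def)
    finally show ?thesis by simp
  qed
  \<comment> \<open>These terms are nonnegative because \<open>-l \<le> r \<le> 0\<close>, and by the trace conditions they sum to zero.\<close>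
  have nn: "r ^ 3 - l\<^sup>2 * r \<ge> 0" if "r \<in> set ns" for r
  proof -
    have "r ^ 3 - l\<^sup>2 * r = (- r) * ((l - r) * (l + r))"
      by (simp add: power3_eq_cube power2_eq_square algebra_simps)
    also have "\<dots> \<ge> 0"
      using np[OF that] ge[OF that] pos by (intro mult_nonneg_nonneg) auto
    finally show ?thesis .
  qed
  have "(\<Sum>r\<leftarrow>ns. r ^ 3 - l\<^sup>2 * r) = (\<Sum>r\<leftarrow>ns. r ^ 3) - l\<^sup>2 * (\<Sum>r\<leftarrow>ns. r)"
    by (simp add: sum_list_subtractf sum_list_const_mult)
  also have "\<dots> = 0"
    using s1 s3 split[of "\<lambda>r. r"] split[of "\<lambda>r. r ^ 3"]
    by (simp add: power3_eq_cube power2_eq_square add_eq_0_iff)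
  finally have "\<forall>r\<in>set ns. r ^ 3 - l\<^sup>2 * r = 0"
    using nn by (subst (asm) sum_list_nonneg_eq_0_iff) auto
  then have cases: "r = 0 \<or> r = - l" if "r \<in> set ns" for r
    using that np[OF that] pos
    by (auto simp: power3_eq_cube power2_eq_square square_eq_iff)
  \<comment> \<open>On \<open>0\<close> and \<open>- l\<close> the square of \<open>r\<close> agrees
    with \<open>- l * r\<close>, so this sum reduces to the sum of the nonpositive entries, which is
    \<open>- l\<close>.\<close>
  have "(\<Sum>r\<leftarrow>ns. r\<^sup>2) = (\<Sum>r\<leftarrow>ns. - l * r)"
    by (intro arg_cong[of _ _ sum_list] map_cong) (auto simp: power2_eq_square dest!: cases)
  also have "\<dots> = l\<^sup>2"
    using s1 split[of "\<lambda>r. r"] sum_list_const_mult[of "- l" "\<lambda>r. r" ns]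
    by (simp add: power2_eq_square eq_neg_iff_add_eq_0[symmetric])
  finally have s2: "(\<Sum>r\<leftarrow>rs. r\<^sup>2) = 2 * l\<^sup>2"
    using split[of "\<lambda>r. r\<^sup>2"] by simp
  have "(\<Sum>r\<leftarrow>ns. r ^ 4) = (\<Sum>r\<leftarrow>ns. l\<^sup>2 * r\<^sup>2)"
    by (intro arg_cong[of _ _ sum_list] map_cong) (auto simp: power4_eq_xxxx power2_eq_square dest!: cases)
  then have s4: "(\<Sum>r\<leftarrow>rs. r ^ 4) = 2 * l ^ 4"
    using s2 split[of "\<lambda>r. r ^ 4"] split[of "\<lambda>r. r\<^sup>2"]
    by (simp add: sum_list_const_mult power4_eq_xxxx power2_eq_square)
  show "(\<Sum>r\<leftarrow>rs. r\<^sup>2) > 0" "2 * (\<Sum>r\<leftarrow>rs. r ^ 4) = (\<Sum>r\<leftarrow>rs. r\<^sup>2)\<^sup>2"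
    unfolding s2 s4 using pos by (auto simp: power4_eq_xxxx power2_eq_square)
qed

text \<open>Used with \<open>c\<close> the product of the part sizes; the cubic condition is then
  \<open>A^3 = c A\<close> read on eigenvalues.\<close>

lemma one_positive_if_power_sums:
  fixes rs :: "real list"
  assumes c: "c > 0" and cube: "\<And>r. r \<in> set rs \<Longrightarrow> r ^ 3 = c * r"
    and s1: "(\<Sum>r\<leftarrow>rs. r) = 0" and s2: "(\<Sum>r\<leftarrow>rs. r\<^sup>2) = 2 * c"
  shows "length (filter (\<lambda>r. 0 < r) rs) = 1"
proof -
  \<comment> \<open>The roots of \<open>r\<^sup>3 = c r\<close> are \<open>0\<close> and \<open>\<plusminus> sqrt c\<close>; this weight vanishes on the nonpositive ones.\<close>
  have f: "r\<^sup>2 + sqrt c * r = (if 0 < r then 2 * c else 0)" if "r \<in> set rs" for r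
  proof -
    have "r * (r\<^sup>2 - c) = 0"
      using cube[OF that] by (simp add: power3_eq_cube power2_eq_square algebra_simps)
    then have "r = 0 \<or> \<bar>r\<bar> = sqrt c"
      by (auto simp: real_sqrt_abs[symmetric] simp del: real_sqrt_abs)
    then consider "r = 0" | "0 < r" "r = sqrt c" | "r < 0" "r = - sqrt c"
      by (metis abs_if linorder_neqE_linordered_idom minus_equation_iff)
    then show ?thesis
      using c by cases (auto simp: power2_eq_square)
  qed
  \<comment> \<open>Summing the weight compares \<open>2 * c\<close> with \<open>2 * c\<close> times
    the number of positive entries.\<close>
  have "2 * c = (\<Sum>r\<leftarrow>rs. r\<^sup>2 + sqrt c * r)"
    using s1 s2 by (simp add: sum_list_addf sum_list_const_mult)
  also have "\<dots> = (\<Sum>r\<leftarrow>rs. if 0 < r then 2 * c else 0)"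
    using f by (intro arg_cong[of _ _ sum_list] map_cong) auto
  also have "\<dots> = 2 * c * real (length (filter (\<lambda>r. 0 < r) rs))"
    by (induction rs) (auto simp: algebra_simps)
  finally show ?thesis using c by simp
qed

section \<open>Matrices indexed by vertices\<close>

text \<open>The matrix product for matrices indexed by the vertices themselves, so that walks can be
  summed without reference to an enumeration.\<close>

definition kernel_comp :: "'a set \<Rightarrow> ('a \<Rightarrow> 'a \<Rightarrow> complex) \<Rightarrow> ('a \<Rightarrow> 'a \<Rightarrow> complex) \<Rightarrow> 'a \<Rightarrow> 'a \<Rightarrow> complex" where
  "kernel_comp X f g u v = (\<Sum>w\<in>X. f u w * g w v)"

definition kernel_mat :: "'a list \<Rightarrow> ('a \<Rightarrow> 'a \<Rightarrow> complex) \<Rightarrow> complex mat" where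
  "kernel_mat vs f = Matrix.mat (length vs) (length vs) (\<lambda>(p, q). f (vs ! p) (vs ! q))"

lemma kernel_mat_carrier [simp]: "kernel_mat vs f \<in> carrier_mat (length vs) (length vs)"
  by (simp add: kernel_mat_def)

lemma sum_nth_distinct:
  assumes "distinct vs"
  shows "(\<Sum>i<length vs. f (vs ! i)) = sum f (set vs)"
  by (rule sum.reindex_bij_betw[OF bij_betw_nth[OF assms refl refl]])

lemma mat_trace_kernel_mat:
  "distinct vs \<Longrightarrow> mat_trace (kernel_mat vs f) = (\<Sum>u\<in>set vs. f u u)"
  using sum_nth_distinct[of vs "\<lambda>u. f u u"] by (simp add: mat_trace_def kernel_mat_def)

text \<open>Distinctness makes positions in \<open>vs\<close> correspond to vertices, so the inner
  sum meets each vertex once.\<close>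

lemma kernel_mat_mult:
  assumes "distinct vs"
  shows "kernel_mat vs f * kernel_mat vs g = kernel_mat vs (kernel_comp (set vs) f g)"
proof (rule eq_matI)
  fix i j
  assume ij: "i < dim_row (kernel_mat vs (kernel_comp (set vs) f g))"
    "j < dim_col (kernel_mat vs (kernel_comp (set vs) f g))"
  then have "(kernel_mat vs f * kernel_mat vs g) $$ (i, j)
    = (\<Sum>l<length vs. f (vs ! i) (vs ! l) * g (vs ! l) (vs ! j))"
    by (subst index_mult_mat_sum[of _ "length vs" "length vs" _ "length vs"])
       (auto simp: kernel_mat_def)
  with ij show "(kernel_mat vs f * kernel_mat vs g) $$ (i, j)
    = kernel_mat vs (kernel_comp (set vs) f g) $$ (i, j)"
    using sum_nth_distinct[OF assms, of "\<lambda>w. f (vs ! i) w * g w (vs ! j)"]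
    by (simp add: kernel_mat_def kernel_comp_def)
qed (auto simp: kernel_mat_def)

lemma kernel_mat_pow:
  assumes "distinct vs"
  shows "kernel_mat vs f ^\<^sub>m 1 = kernel_mat vs f"
    and "kernel_mat vs f ^\<^sub>m 2 = kernel_mat vs (kernel_comp (set vs) f f)"
    and "kernel_mat vs f ^\<^sub>m 3 = kernel_mat vs (kernel_comp (set vs) (kernel_comp (set vs) f f) f)"
    and "kernel_mat vs f ^\<^sub>m 4 =
      kernel_mat vs (kernel_comp (set vs) (kernel_comp (set vs) f f) (kernel_comp (set vs) f f))"
proof -
  let ?M = "kernel_mat vs f"
  show 1: "?M ^\<^sub>m 1 = ?M"
    using left_mult_one_mat[OF kernel_mat_carrier[of vs f]] by (simp add: kernel_mat_def)
  show 2: "?M ^\<^sub>m 2 = kernel_mat vs (kernel_comp (set vs) f f)"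
    using 1 by (simp add: numeral_2_eq_2 kernel_mat_mult[OF assms])
  show 3: "?M ^\<^sub>m 3 = kernel_mat vs (kernel_comp (set vs) (kernel_comp (set vs) f f) f)"
    using 2 by (simp add: numeral_3_eq_3 numeral_2_eq_2 kernel_mat_mult[OF assms])
  \<comment> \<open>Regrouping as a square times a square writes the fourth trace through products
    of two entries of the square, as Lagrange's identity requires.\<close>
  have "?M ^\<^sub>m 4 = ?M ^\<^sub>m 2 * ?M * ?M"
    by (simp add: eval_nat_numeral)
  also have "\<dots> = ?M ^\<^sub>m 2 * (?M * ?M)"
    unfolding 2 by (rule assoc_mult_mat) (rule kernel_mat_carrier)+
  finally show "?M ^\<^sub>m 4 =
      kernel_mat vs (kernel_comp (set vs) (kernel_comp (set vs) f f) (kernel_comp (set vs) f f))"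
    unfolding 2 by (simp add: kernel_mat_mult[OF assms])
qed

section \<open>Lagrange's identity and vanishing minors\<close>

text \<open>Lagrange's identity in bilinear form; \<open>y\<close> will be the conjugate of
  \<open>x\<close>. The product of two minors expands into four terms, each of which factors into a
  sum over \<open>r\<close> times a sum over \<open>s\<close>.\<close>

lemma sum_minor_products:
  fixes x y :: "'a \<Rightarrow> 'b \<Rightarrow> 'c::comm_ring_1"
  shows "(\<Sum>p\<in>P. \<Sum>q\<in>P. \<Sum>r\<in>X. \<Sum>s\<in>X.
      (x p r * x q s - x p s * x q r) * (y p r * y q s - y p s * y q r))
    = 2 * (\<Sum>p\<in>P. \<Sum>r\<in>X. x p r * y p r)\<^sup>2
      - 2 * (\<Sum>p\<in>P. \<Sum>q\<in>P. (\<Sum>r\<in>X. x p r * y q r) * (\<Sum>r\<in>X. x q r * y p r))"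
proof -
  have inner: "(\<Sum>r\<in>X. \<Sum>s\<in>X. (x p r * x q s - x p s * x q r) * (y p r * y q s - y p s * y q r))
    = 2 * ((\<Sum>r\<in>X. x p r * y p r) * (\<Sum>r\<in>X. x q r * y q r))
      - 2 * ((\<Sum>r\<in>X. x p r * y q r) * (\<Sum>r\<in>X. x q r * y p r))" for p q
  proof -
    have "(\<Sum>r\<in>X. \<Sum>s\<in>X. (x p r * x q s - x p s * x q r) * (y p r * y q s - y p s * y q r))
      = (\<Sum>r\<in>X. \<Sum>s\<in>X. (x p r * y p r) * (x q s * y q s))
        + (\<Sum>r\<in>X. \<Sum>s\<in>X. (x q r * y q r) * (x p s * y p s))
        - (\<Sum>r\<in>X. \<Sum>s\<in>X. (x p r * y q r) * (x q s * y p s))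
        - (\<Sum>r\<in>X. \<Sum>s\<in>X. (x q r * y p r) * (x p s * y q s))"
      unfolding sum.distrib[symmetric] sum_subtractf[symmetric]
      by (intro sum.cong refl) (simp add: algebra_simps)
    then show ?thesis
      unfolding sum_product[symmetric] by (simp add: algebra_simps)
  qed
  show ?thesis
    unfolding inner sum_subtractf sum_distrib_left[symmetric] sum_distrib_right[symmetric] power2_eq_square ..
qed

text \<open>A Hermitian matrix with two zero diagonal blocks, as an abstract setting for the trace
  computations.\<close>

locale bipartite_kernel =
  fixes a :: "'a \<Rightarrow> 'a \<Rightarrow> complex" and U V :: "'a set"
  assumes finU: "finite U" and finV: "finite V" and disj: "U \<inter> V = {}"
    and herm: "a v u = cnj (a u v)"
    and zeroU: "u \<in> U \<Longrightarrow> v \<in> U \<Longrightarrow> a u v = 0"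
    and zeroV: "u \<in> V \<Longrightarrow> v \<in> V \<Longrightarrow> a u v = 0"
begin

abbreviation X where "X \<equiv> U \<union> V"
abbreviation b where "b \<equiv> kernel_comp X a a"

lemma swap: "bipartite_kernel a V U"
  using finU finV disj zeroU zeroV by unfold_locales (auto simp: Int_commute intro: herm)

lemma sum_X: "sum f X = sum f U + sum f V"
  using finU finV disj by (rule sum.union_disjoint)

text \<open>Every middle vertex shares a part with \<open>p\<close> or with \<open>q\<close>, so one
  factor of each term vanishes.\<close>

lemma b_cross: "b p q = 0" "b q p = 0" if "p \<in> U" "q \<in> V"
  using that zeroU zeroV by (auto simp: kernel_comp_def intro!: sum.neutral)

lemma trace1: "(\<Sum>u\<in>X. a u u) = 0"
  using zeroU zeroV by (auto intro!: sum.neutral)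

text \<open>In \<open>b u w * a w u\<close> the first factor vanishes across the parts and the
  second within a part.\<close>

lemma trace3: "(\<Sum>u\<in>X. kernel_comp X b a u u) = 0"
  using b_cross zeroU zeroV by (fastforce simp: kernel_comp_def[of X b a] intro!: sum.neutral)

text \<open>Both parts contribute equally, since each product \<open>a p r * a r p\<close> is met
  once from either end.\<close>

lemma trace2_parts: "(\<Sum>u\<in>X. b u u) = 2 * (\<Sum>p\<in>U. \<Sum>r\<in>X. a p r * a r p)"
proof -
  have "(\<Sum>p\<in>U. \<Sum>r\<in>X. a p r * a r p) = (\<Sum>p\<in>U. \<Sum>r\<in>V. a p r * a r p)"
    unfolding sum_X using zeroU by simp
  moreover have "(\<Sum>p\<in>V. \<Sum>r\<in>X. a p r * a r p) = (\<Sum>p\<in>V. \<Sum>r\<in>U. a p r * a r p)"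
    unfolding sum_X using zeroV by simp
  moreover have "(\<Sum>p\<in>V. \<Sum>r\<in>U. a p r * a r p) = (\<Sum>p\<in>U. \<Sum>r\<in>V. a p r * a r p)"
    by (subst sum.swap) (simp add: mult.commute)
  ultimately show ?thesis
    by (simp add: kernel_comp_def sum_X[of "\<lambda>u. \<Sum>w\<in>X. a u w * a w u"])
qed

lemma trace4_parts:
  "(\<Sum>u\<in>X. kernel_comp X b b u u) = (\<Sum>p\<in>U. \<Sum>q\<in>U. b p q * b q p) + (\<Sum>p\<in>V. \<Sum>q\<in>V. b p q * b q p)"
  unfolding kernel_comp_def[of X b b] sum_X by (simp add: b_cross)

text \<open>Kept real so that nonnegativity can pass a zero total on to each minor. The columns run
  over ordered pairs, hence the factors 2 in \<open>minor_sum_eq\<close>.\<close>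

definition minor_sum :: "'a set \<Rightarrow> real" where
  "minor_sum P = (\<Sum>p\<in>P. \<Sum>q\<in>P. \<Sum>r\<in>X. \<Sum>s\<in>X. (cmod (a p r * a q s - a p s * a q r))\<^sup>2)"

text \<open>Lagrange's identity with \<open>a r p\<close>, the conjugate of \<open>a p r\<close>, in
  the place of \<open>y p r\<close>.\<close>

lemma minor_sum_eq:
  "complex_of_real (minor_sum P)
    = 2 * (\<Sum>p\<in>P. \<Sum>r\<in>X. a p r * a r p)\<^sup>2 - 2 * (\<Sum>p\<in>P. \<Sum>q\<in>P. b p q * b q p)"
proof -
  have "complex_of_real (minor_sum P) = (\<Sum>p\<in>P. \<Sum>q\<in>P. \<Sum>r\<in>X. \<Sum>s\<in>X.
      (a p r * a q s - a p s * a q r) * (a r p * a s q - a s p * a r q))"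
    unfolding minor_sum_def of_real_sum
    by (intro sum.cong refl)
       (simp only: complex_norm_square of_real_power[symmetric] complex_cnj_diff complex_cnj_mult herm[symmetric])
  also have "\<dots> = 2 * (\<Sum>p\<in>P. \<Sum>r\<in>X. a p r * a r p)\<^sup>2 - 2 * (\<Sum>p\<in>P. \<Sum>q\<in>P. b p q * b q p)"
    unfolding kernel_comp_def by (rule sum_minor_products)
  finally show ?thesis .
qed

lemma minors_vanish:
  assumes T: "2 * (\<Sum>u\<in>X. kernel_comp X b b u u) = (\<Sum>u\<in>X. b u u)\<^sup>2"
    and pq: "p \<in> U \<and> q \<in> U \<or> p \<in> V \<and> q \<in> V" and rs: "r \<in> X" "s \<in> X"
  shows "a p r * a q s = a p s * a q r"
proof -
  interpret sw: bipartite_kernel a V U by (rule swap)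
  have sX: "V \<union> U = X" by auto
  have EV: "(\<Sum>u\<in>X. b u u) = 2 * (\<Sum>p\<in>V. \<Sum>r\<in>X. a p r * a r p)"
    using sw.trace2_parts unfolding sX .
  \<comment> \<open>Each part carries half of the second trace \<open>t\<close>, so the squared
    terms add up to \<open>2 * (t/2)^2 + 2 * (t/2)^2 = t^2\<close>.\<close>
  have "complex_of_real (minor_sum U + minor_sum V)
    = (\<Sum>u\<in>X. b u u)\<^sup>2 - 2 * (\<Sum>u\<in>X. kernel_comp X b b u u)"
    unfolding of_real_add minor_sum_eq trace4_parts
    using trace2_parts EV by (simp add: power2_eq_square algebra_simps)
  then have "complex_of_real (minor_sum U + minor_sum V) = of_real 0"
    using T by simp
  then have z: "minor_sum U + minor_sum V = 0"
    unfolding of_real_eq_iff .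
  have nn: "minor_sum P \<ge> 0" for P
    unfolding minor_sum_def by (intro sum_nonneg) auto
  have vanish: "minor_sum P = 0 \<Longrightarrow> finite P \<Longrightarrow> p \<in> P \<Longrightarrow> q \<in> P \<Longrightarrow> ?thesis" for P
    using rs finU finV unfolding minor_sum_def by (auto simp: sum_nonneg_eq_0_iff sum_nonneg)
  have "minor_sum U = 0" "minor_sum V = 0"
    using z nn[of U] nn[of V] by linarith+
  then show ?thesis
    using vanish[of U] vanish[of V] pq finU finV by blast
qed

end

section \<open>Gain graphs\<close>

context T_gain_graph
begin

text \<open>The default 0 hides the arbitrary values of \<open>\<phi>\<close> off the arcs; as gains
  are nonzero, the support is exactly the arc set.\<close>

definition weight :: "'a \<Rightarrow> 'a \<Rightarrow> complex" where
  "weight u v = (if (u, v) \<in> parcs G then \<phi> (u, v) else 0)"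

lemma weight_eq_0_iff: "weight u v = 0 \<longleftrightarrow> (u, v) \<notin> parcs G"
  using gain_unit[of "(u, v)"] by (auto simp: weight_def)

text \<open>On the unit circle inversion is conjugation.\<close>

lemma weight_herm: "weight v u = cnj (weight u v)"
proof (cases "(u, v) \<in> parcs G")
  case True
  have "\<phi> (u, v) * cnj (\<phi> (u, v)) = 1"
    using gain_unit[OF True] by (simp add: complex_norm_square[symmetric])
  then have "inverse (\<phi> (u, v)) = cnj (\<phi> (u, v))"
    by (rule inverse_unique)
  then show ?thesis
    using True arcs_symmetric[OF True] gain_reverse[OF True] by (simp add: weight_def)
next
  case False
  then show ?thesis
    using arcs_symmetric[of v u] by (auto simp: weight_def)
qed

lemma weight_inverse: "(u, v) \<in> parcs G \<Longrightarrow> weight u v * weight v u = 1"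
  using arcs_symmetric[of u v] gain_reverse[of u v] gain_unit[of "(u, v)"]
  by (auto simp: weight_def intro!: right_inverse)

lemma adjacency_mat_eq: "adjacency_mat vs G \<phi> = kernel_mat vs weight"
  by (simp add: adjacency_mat_def kernel_mat_def weight_def)

lemma bipartite_kernel_weight:
  assumes "pverts G = U \<union> V" "U \<inter> V = {}" "parcs G \<subseteq> U \<times> V \<union> V \<times> U"
  shows "bipartite_kernel weight U V"
proof
  show "finite U" "finite V"
    using pair_finite_verts assms(1) by auto
qed (use assms in \<open>auto simp: weight_eq_0_iff intro: weight_herm\<close>)

lemma weight_spectrum:
  assumes "distinct vs" "set vs = pverts G"
  obtains rs :: "real list" where
    "num_pos_eigenvalues (adjacency_mat vs G \<phi>) = length (filter (\<lambda>r. 0 < r) rs)"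
    "\<And>r. r \<in> set rs \<Longrightarrow> eigenvalue (kernel_mat vs weight) (complex_of_real r)"
    "\<And>k. mat_trace (kernel_mat vs weight ^\<^sub>m k) = complex_of_real (\<Sum>r\<leftarrow>rs. r ^ k)"
proof (rule hermitian_spectrum[of "kernel_mat vs weight" "length vs"])
  show "kernel_mat vs weight $$ (j, i) = cnj (kernel_mat vs weight $$ (i, j))"
    if "i < length vs" "j < length vs" for i j
    using that weight_herm[of "vs ! j" "vs ! i"] by (simp add: kernel_mat_def)
qed (use that in \<open>auto simp: adjacency_mat_eq\<close>)

section \<open>Potentials and balance\<close>

text \<open>Gains that are quotients of a potential telescope along a walk.\<close>

lemma gain_potential:
  assumes "\<And>u v. (u, v) \<in> parcs G \<Longrightarrow> \<phi> (u, v) * \<theta> v = \<theta> u"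
  shows "set p \<subseteq> parcs G \<Longrightarrow> pcas u p v \<Longrightarrow> gain \<phi> p * \<theta> v = \<theta> u"
proof (induction p arbitrary: u)
  case (Cons e p)
  then have "gain \<phi> (e # p) * \<theta> v = \<phi> e * \<theta> (snd e)"
    by (simp add: gain_def mult.assoc)
  then show ?case
    using Cons.prems assms[of "fst e" "snd e"] by (cases e) auto
qed (simp add: gain_def)

text \<open>On a closed walk the two end values of \<open>\<theta>\<close> coincide and
  cancel.\<close>

lemma balanced_if_potential:
  assumes "\<And>u v. (u, v) \<in> parcs G \<Longrightarrow> \<phi> (u, v) * \<theta> v = \<theta> u"
    and "\<And>v. v \<in> pverts G \<Longrightarrow> \<theta> v \<noteq> 0"
  shows "balanced G \<phi>"
  unfolding balanced_def
proof (intro allI impI)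
  fix p
  assume "pre_digraph.cycle (with_proj G) p \<and> 3 \<le> length p"
  then obtain u where "u \<in> pverts G" "set p \<subseteq> parcs G" "pcas u p u"
    by (auto simp: pre_digraph.cycle_def pre_digraph.awalk_def cas_with_proj_eq)
  then show "gain \<phi> p = 1"
    using gain_potential[OF assms(1), of p u u] assms(2)[of u] by simp
qed

section \<open>From one positive eigenvalue to a balanced complete bipartite graph\<close>

lemma adjacent_if_minors_vanish:
  assumes V: "pverts G = U \<union> V" "U \<inter> V = {}" "parcs G \<subseteq> U \<times> V \<union> V \<times> U"
    and minors: "\<And>p q r s. p \<in> U \<Longrightarrow> q \<in> U \<Longrightarrow> r \<in> V \<Longrightarrow> s \<in> V \<Longrightarrow>
      weight p r * weight q s = weight p s * weight q r"
    and u: "u \<in> U" and w: "w \<in> V" and reach: "u \<rightarrow>\<^sup>*\<^bsub>with_proj G\<^esub> w"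
  shows "(u, w) \<in> parcs G"
proof -
  \<comment> \<open>The product \<open>weight u r * weight q s\<close> is nonzero, so the vanishing
    minor makes \<open>weight u s\<close> nonzero as well.\<close>
  have three_path: "(u, s) \<in> parcs G" if "(u, r) \<in> parcs G" "(r, q) \<in> parcs G" "(q, s) \<in> parcs G" for r q s
  proof -
    have "r \<in> V" using that u V by blast
    moreover from this have "q \<in> U" using that V by blast
    moreover from this have "s \<in> V" using that V by blast
    moreover have "(q, r) \<in> parcs G"
      using arcs_symmetric that by blast
    ultimately show ?thesis
      using minors[OF u, of q r s] that weight_eq_0_iff
      by (metis mult_eq_0_iff)
  qed
  \<comment> \<open>Invariant of the induction: a reached vertex of \<open>V\<close> is a neighbour
    of \<open>u\<close>, and one of \<open>U\<close> is \<open>u\<close> or two steps away;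
    \<open>three_path\<close> shortens any longer walk.\<close>
  from reach have "w = u \<or> (if w \<in> V then (u, w) \<in> parcs G else \<exists>r. (u, r) \<in> parcs G \<and> (r, w) \<in> parcs G)"
  proof (induction rule: reachable_induct)
    case (step x y)
    then have xy: "(x, y) \<in> parcs G" by simp
    consider "x = u" | "x \<noteq> u" "x \<in> V" | "x \<noteq> u" "x \<notin> V" by blast
    then show ?case
    proof cases
      case 1
      then show ?thesis using xy u V by auto
    next
      case 2
      then show ?thesis using xy V step.IH by auto
    next
      case 3
      then obtain r where "(u, r) \<in> parcs G" "(r, x) \<in> parcs G"
        using step.IH by auto
      then show ?thesis using three_path xy 3 V by auto
    qed
  qed simp
  then show ?thesis using u w V by auto
qed

lemma complete_bipartite_balanced_if_one_positive:
  assumes conn: "Digraph_Component.connected (with_proj G)" and bip: "bipartite G"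
    and vs: "distinct vs" "set vs = pverts G"
    and one: "num_pos_eigenvalues (adjacency_mat vs G \<phi>) = 1"
  shows "balanced G \<phi>" "complete_bipartite G"
proof -
  obtain U V where UV: "pverts G = U \<union> V" "U \<inter> V = {}" "parcs G \<subseteq> U \<times> V \<union> V \<times> U"
    using bip unfolding bipartite_def by blast
  interpret bk: bipartite_kernel weight U V
    by (rule bipartite_kernel_weight[OF UV])
  obtain rs where rs: "num_pos_eigenvalues (adjacency_mat vs G \<phi>) = length (filter (\<lambda>r. 0 < r) rs)"
    "\<And>k. mat_trace (kernel_mat vs weight ^\<^sub>m k) = complex_of_real (\<Sum>r\<leftarrow>rs. r ^ k)"
    using weight_spectrum[OF vs] by metis
  note tr = mat_trace_kernel_mat[OF vs(1)] vs(2) UV(1)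
  have tr1: "complex_of_real (\<Sum>r\<leftarrow>rs. r) = 0"
    using rs(2)[of 1] bk.trace1 by (simp add: kernel_mat_pow[OF vs(1)] tr)
  have tr3: "complex_of_real (\<Sum>r\<leftarrow>rs. r ^ 3) = 0"
    using rs(2)[of 3] bk.trace3 by (simp add: kernel_mat_pow[OF vs(1)] tr)
  have tr2: "complex_of_real (\<Sum>r\<leftarrow>rs. r\<^sup>2) = (\<Sum>u\<in>U \<union> V. bk.b u u)"
    using rs(2)[of 2] by (simp add: kernel_mat_pow[OF vs(1)] tr)
  have tr4: "complex_of_real (\<Sum>r\<leftarrow>rs. r ^ 4) = (\<Sum>u\<in>U \<union> V. kernel_comp (U \<union> V) bk.b bk.b u u)"
    using rs(2)[of 4] by (simp add: kernel_mat_pow[OF vs(1)] tr)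
  have ps: "(\<Sum>r\<leftarrow>rs. r\<^sup>2) > 0" "2 * (\<Sum>r\<leftarrow>rs. r ^ 4) = (\<Sum>r\<leftarrow>rs. r\<^sup>2)\<^sup>2"
    using one_positive_power_sums[of rs] one rs(1) tr1 tr3 by auto
  have T: "2 * (\<Sum>u\<in>U \<union> V. kernel_comp (U \<union> V) bk.b bk.b u u) = (\<Sum>u\<in>U \<union> V. bk.b u u)\<^sup>2"
    unfolding tr2[symmetric] tr4[symmetric] using arg_cong[OF ps(2), of complex_of_real] by simp
  have minors: "weight p r * weight q s = weight p s * weight q r"
    if "p \<in> U" "q \<in> U" "r \<in> V" "s \<in> V" for p q r s
    using bk.minors_vanish[OF T, of p q r s] that by simp
  have reach: "u \<rightarrow>\<^sup>*\<^bsub>with_proj G\<^esub> v" if "u \<in> pverts G" "v \<in> pverts G" for u v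
    using conn that reachable_mk_symmetric_eq[OF pair_sym_arcs]
    by (auto simp: connected_def)
  \<comment> \<open>A positive second trace excludes the one-vertex graph and supplies the base arc
    \<open>(x, y)\<close> of the potential.\<close>
  have "parcs G \<noteq> {}"
  proof
    assume "parcs G = {}"
    then have "(\<Sum>u\<in>U \<union> V. bk.b u u) = 0"
      by (simp add: kernel_comp_def weight_def)
    then show False using tr2 ps(1) by simp
  qed
  then obtain x y where xy: "x \<in> U" "y \<in> V" "(x, y) \<in> parcs G"
    using UV arcs_symmetric by blast
  have adj: "(u, v) \<in> parcs G" if "u \<in> U" "v \<in> V" for u v
    using adjacent_if_minors_vanish[OF UV minors that reach] that UV(1) by auto
  then have arcs: "parcs G = U \<times> V \<union> V \<times> U"
    using UV(3) arcs_symmetric by blast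
  have "card U \<ge> 1" "card V \<ge> 1"
    using xy bk.finU bk.finV by (auto simp: Suc_le_eq card_gt_0_iff)
  then show "complete_bipartite G"
    unfolding complete_bipartite_def complete_bipartite_digraph_pair_def
    using pair_finite_verts UV arcs by blast
  \<comment> \<open>\<open>\<theta> v\<close> is the gain of a walk from \<open>v\<close> to
    \<open>y\<close>: the arc itself if \<open>v\<close> lies in \<open>U\<close>, the detour
    through \<open>x\<close> if it lies in \<open>V\<close>.\<close>
  define \<theta> where "\<theta> v = (if v \<in> U then weight v y else weight x y * weight v x)" for v
  show "balanced G \<phi>"
  proof (rule balanced_if_potential)
    show "\<theta> v \<noteq> 0" if "v \<in> pverts G" for v
      using that xy arcs UV by (auto simp: \<theta>_def weight_eq_0_iff)
    have UV': "weight u v * \<theta> v = \<theta> u" "weight v u * \<theta> u = \<theta> v" if "u \<in> U" "v \<in> V" for u v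
    proof -
      \<comment> \<open>The minor with rows \<open>u\<close>, \<open>x\<close> and columns
        \<open>v\<close>, \<open>y\<close>.\<close>
      have m: "weight u v * weight x y = weight u y * weight x v"
        using minors that xy by blast
      have i: "weight x v * weight v x = 1" "weight v u * weight u v = 1"
        using weight_inverse adj arcs_symmetric that xy by blast+
      have "v \<notin> U" using that UV by blast
      then have "weight u v * \<theta> v = (weight u y * weight x v) * weight v x"
        by (simp add: \<theta>_def m[symmetric])
      also have "\<dots> = \<theta> u"
        using i(1) that by (simp add: \<theta>_def mult.assoc)
      finally show 1: "weight u v * \<theta> v = \<theta> u" .
      show "weight v u * \<theta> u = \<theta> v"
        unfolding 1[symmetric] mult.assoc[symmetric] i(2) by simp
    qed
    show "\<phi> (u, v) * \<theta> v = \<theta> u" if "(u, v) \<in> parcs G" for u v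
      using UV'[of u v] UV'[of v u] that arcs by (auto simp: weight_def)
  qed
qed

section \<open>From a balanced complete bipartite graph to one positive eigenvalue\<close>

text \<open>The walk \<open>u, x, w, v\<close> is closed by the arc \<open>(v, u)\<close> to a
  4-cycle of gain 1.\<close>

lemma balanced_square:
  assumes bal: "balanced G \<phi>" and arcs: "parcs G = U \<times> V \<union> V \<times> U" and disj: "U \<inter> V = {}"
    and u: "u \<in> U" "w \<in> U" and v: "v \<in> V" "x \<in> V"
  shows "weight u x * weight x w * weight w v = weight u v"
\<comment> \<open>Here the closed walk is not a cycle, but it runs along an edge and straight back,
  and these two weights cancel.\<close>
proof (cases "u = w \<or> x = v")
  case True
  have "weight u x * weight x u = 1" "weight x w * weight w x = 1"
    using weight_inverse arcs u v by blast+
  then show ?thesis using True by (auto simp: mult.assoc)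
next
  case False
  let ?p = "[(u, x), (x, w), (w, v), (v, u)]"
  have "pre_digraph.cycle (with_proj G) ?p"
    unfolding pre_digraph.cycle_def pre_digraph.awalk_def cas_with_proj_eq awalk_verts_with_proj_eq
    using False u v arcs disj arc_fst_in_verts[of "(u, x)"] by (intro exI[of _ u]) auto
  then have "gain \<phi> ?p = 1"
    using bal by (auto simp: balanced_def)
  then have "weight u x * weight x w * weight w v * weight v u = 1"
    using u v arcs by (simp add: gain_def weight_def mult.assoc)
  moreover have "weight v u * weight u v = 1"
    using weight_inverse arcs u v by blast
  ultimately show ?thesis
    by (metis mult.assoc mult.right_neutral mult.left_neutral)
qed

text \<open>There are \<open>card U * card V\<close> walks of length three from \<open>u\<close> to
  \<open>v\<close>, and each has the weight of the arc \<open>(u, v)\<close>.\<close>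

lemma balanced_cube:
  assumes bal: "balanced G \<phi>" and arcs: "parcs G = U \<times> V \<union> V \<times> U" and disj: "U \<inter> V = {}"
    and fin: "finite U" "finite V" and uv: "u \<in> U" "v \<in> V"
  shows "kernel_comp (U \<union> V) (kernel_comp (U \<union> V) weight weight) weight u v
    = of_nat (card U * card V) * weight u v"
proof -
  have zU: "weight p q = 0" if "p \<in> U" "q \<in> U" for p q
    using that arcs disj by (auto simp: weight_eq_0_iff)
  have zV: "weight p q = 0" if "p \<in> V" "q \<in> V" for p q
    using that arcs disj by (auto simp: weight_eq_0_iff)
  have "kernel_comp (U \<union> V) (kernel_comp (U \<union> V) weight weight) weight u v
    = (\<Sum>w\<in>U. \<Sum>x\<in>V. weight u x * weight x w * weight w v)"
    unfolding kernel_comp_def using uv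
    by (simp add: sum.union_disjoint[OF fin disj] zU zV sum_distrib_right)
  also have "\<dots> = (\<Sum>w\<in>U. \<Sum>x\<in>V. weight u v)"
    using balanced_square[OF bal arcs disj] uv by simp
  finally show ?thesis by simp
qed

lemma one_positive_if_complete_bipartite_balanced:
  assumes vs: "distinct vs" "set vs = pverts G"
    and bal: "balanced G \<phi>" and cb: "complete_bipartite G"
  shows "num_pos_eigenvalues (adjacency_mat vs G \<phi>) = 1"
proof -
  obtain U V where UV: "pverts G = U \<union> V" "U \<inter> V = {}" and arcs: "parcs G = U \<times> V \<union> V \<times> U"
    and card: "card U \<ge> 1" "card V \<ge> 1"
    using cb unfolding complete_bipartite_def complete_bipartite_digraph_pair_def by blast
  interpret bk: bipartite_kernel weight U V
    by (rule bipartite_kernel_weight) (use UV arcs in auto)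
  obtain rs where rs: "num_pos_eigenvalues (adjacency_mat vs G \<phi>) = length (filter (\<lambda>r. 0 < r) rs)"
    "\<And>r. r \<in> set rs \<Longrightarrow> eigenvalue (kernel_mat vs weight) (complex_of_real r)"
    "\<And>k. mat_trace (kernel_mat vs weight ^\<^sub>m k) = complex_of_real (\<Sum>r\<leftarrow>rs. r ^ k)"
    using weight_spectrum[OF vs] by metis
  define c where "c = real (card U * card V)"
  have c: "c > 0" using card by (simp add: c_def)
  note tr = mat_trace_kernel_mat[OF vs(1)] vs(2) UV(1)
  have "complex_of_real (\<Sum>r\<leftarrow>rs. r) = 0"
    using rs(3)[of 1] bk.trace1 by (simp add: kernel_mat_pow[OF vs(1)] tr)
  then have s1: "(\<Sum>r\<leftarrow>rs. r) = 0" by simp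
  have "complex_of_real (\<Sum>r\<leftarrow>rs. r\<^sup>2) = 2 * (\<Sum>p\<in>U. \<Sum>r\<in>U \<union> V. weight p r * weight r p)"
    using rs(3)[of 2] bk.trace2_parts by (simp add: kernel_mat_pow[OF vs(1)] tr)
  \<comment> \<open>Each pair across the parts contributes a gain times its inverse, so the sum
    counts pairs.\<close>
  also have "(\<Sum>p\<in>U. \<Sum>r\<in>U \<union> V. weight p r * weight r p) = (\<Sum>p\<in>U. \<Sum>r\<in>V. 1)"
    using bk.zeroU weight_inverse arcs by (simp add: bk.sum_X)
  also have "2 * \<dots> = complex_of_real (2 * c)"
    by (simp add: c_def)
  finally have s2: "(\<Sum>r\<leftarrow>rs. r\<^sup>2) = 2 * c"
    unfolding of_real_eq_iff .
  have arcs': "parcs G = V \<times> U \<union> U \<times> V" and disj': "V \<inter> U = {}" and X': "V \<union> U = U \<union> V"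
    using arcs UV by auto
  have cube: "kernel_comp (U \<union> V) bk.b weight u v = of_real c * weight u v"
    if uv: "u \<in> U \<union> V" "v \<in> U \<union> V" for u v
  proof -
    consider "u \<in> U" "v \<in> V" | "u \<in> V" "v \<in> U" | "u \<in> U" "v \<in> U" | "u \<in> V" "v \<in> V"
      using uv by blast
    then show ?thesis
    proof cases
      case 1
      then show ?thesis
        using balanced_cube[OF bal arcs UV(2) bk.finU bk.finV] by (simp add: c_def)
    next
      case 2
      then show ?thesis
        using balanced_cube[OF bal arcs' disj' bk.finV bk.finU] unfolding X'
        by (simp add: c_def mult.commute)
    next
      case 3
      then show ?thesis
        using bk.b_cross bk.zeroU by (auto simp: kernel_comp_def[of _ bk.b weight] bk.sum_X)
    next
      case 4
      then show ?thesis
        using bk.b_cross bk.zeroV by (auto simp: kernel_comp_def[of _ bk.b weight] bk.sum_X)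
    qed
  qed
  let ?A = "kernel_mat vs weight"
  have A3: "?A ^\<^sub>m 3 = complex_of_real c \<cdot>\<^sub>m ?A"
    unfolding kernel_mat_pow[OF vs(1)] vs(2) UV(1)
    using cube vs(2) UV(1) nth_mem[of _ vs] by (intro eq_matI) (auto simp: kernel_mat_def)
  \<comment> \<open>The matrix identity is evaluated on an eigenvector and compared at a nonzero
    coordinate.\<close>
  have "r ^ 3 = c * r" if r: "r \<in> set rs" for r
  proof -
    obtain v where ev: "eigenvector ?A v (complex_of_real r)"
      using rs(2)[OF r] by (auto simp: eigenvalue_def)
    then have v: "v \<in> carrier_vec (length vs)" "v \<noteq> 0\<^sub>v (length vs)" "?A *\<^sub>v v = complex_of_real r \<cdot>\<^sub>v v"
      by (auto simp: eigenvector_def kernel_mat_def)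
    have "complex_of_real r ^ 3 \<cdot>\<^sub>v v = ?A ^\<^sub>m 3 *\<^sub>v v"
      by (rule eigenvector_pow[OF kernel_mat_carrier ev, symmetric])
    also have "\<dots> = complex_of_real c \<cdot>\<^sub>v (complex_of_real r \<cdot>\<^sub>v v)"
      unfolding A3 v(3)[symmetric] using v(1) carrier_matD[OF kernel_mat_carrier[of vs weight]]
      by (intro eq_vecI) (auto simp: scalar_prod_def sum_distrib_left mult.assoc intro!: sum.cong)
    finally have e: "complex_of_real r ^ 3 \<cdot>\<^sub>v v = (complex_of_real c * complex_of_real r) \<cdot>\<^sub>v v"
      by (simp add: smult_smult_assoc)
    obtain i where i: "i < length vs" "v $ i \<noteq> 0"
      using v(1,2) by (metis carrier_vecD eq_vecI index_zero_vec)
    have "complex_of_real r ^ 3 * v $ i = complex_of_real c * complex_of_real r * v $ i"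
      using arg_cong[OF e, of "\<lambda>w. w $ i"] i v(1) by simp
    then have "complex_of_real (r ^ 3) = complex_of_real (c * r)"
      using i(2) by simp
    then show ?thesis unfolding of_real_eq_iff .
  qed
  then show ?thesis
    unfolding rs(1) using one_positive_if_power_sums[OF c _ s1 s2] by blast
qed

end

theorem theorem4p3:
  fixes G :: "'a pair_pre_digraph"
    and \<phi> :: "'a \<times> 'a \<Rightarrow> complex"
    and vs :: "'a list"
  assumes "T_gain_graph G \<phi>"
    and "Digraph_Component.connected (with_proj G)"
    and "bipartite G"
    and "distinct vs" and "set vs = pverts G"
  shows "num_pos_eigenvalues (adjacency_mat vs G \<phi>) = 1 \<longleftrightarrow>
    balanced G \<phi> \<and> complete_bipartite G"
proof -
  interpret T_gain_graph G \<phi> by fact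
  show ?thesis
    using complete_bipartite_balanced_if_one_positive[OF assms(2-5)]
      one_positive_if_complete_bipartite_balanced[OF assms(4,5)] by blast
qed

end
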